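(* Let $P : B(\ell^2) \to B(\ell^2)$ be a non-zero bounded linear idempotent ($P\circ P=P$) that is an $\ell^\infty$-bimodule map, let $\mathcal{M} = P(B(\ell^2))$ denote its range, and assume that $\|P\| < 2/\sqrt{3}$. Then: (i) $P = S_{\chi_E}$, where $E = \bigcup_m I_m \times J_m \subseteq \mathbb{N}\times\mathbb{N}$, with $\{I_m\}$ and $\{J_m\}$ countable collections of pairwise disjoint subsets of $\mathbb{N}$ (the $I_m$ are pairwise disjoint, and the $J_m$ are pairwise disjoint); (ii) $\mathcal{M} = \sum_m \chi_{I_m} B(\ell^2) \chi_{J_m}$ and $\mathcal{M}\mathcal{M}^*\mathcal{M} \subseteq \mathcal{M}$; (iii) $\|P\| = 1$.
   Context: $\ell^2=\ell^2(\mathbb{N})$ and $\ell^\infty$ acts on $\ell^2$ as the diagonal operators. A linear map $\Phi$ on $B(\ell^2)$ is an $\ell^\infty$-bimodule map if $\Phi(D_1TD_2)=D_1\Phi(T)D_2$ for all $T\in B(\ell^2)$ and all diagonal operators $D_1,D_2\in\ell^\infty$. Operators are identified with their matrices $(x_{i,j})$ with respect to the standard basis. For a matrix $A=(a_{i,j})$, $S_A$ denotes the Schur multiplication map $S_A((x_{i,j})) = (a_{i,j}x_{i,j})$. For $E\subseteq\mathbb{N}\times\mathbb{N}$, $\chi_E$ denotes the matrix whose $(i,j)$ entry is $1$ if $(i,j)\in E$ and $0$ otherwise. For $I\subseteq\mathbb{N}$, the operator $\chi_I$ is the diagonal projection onto $\overline{\mathrm{span}}\{e_i : i\in I\}$.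 The sum $\sum_m \chi_{I_m} B(\ell^2) \chi_{J_m}$ is understood as the w*-closed sum, i.e. the w*-closed linear span of the subspaces $\chi_{I_m} B(\ell^2)\chi_{J_m}$. $\mathcal{M}\mathcal{M}^*\mathcal{M} \subseteq \mathcal{M}$ means $m_1m_2^*m_3\in\mathcal{M}$ for all $m_1,m_2,m_3\in\mathcal{M}$. *)

theory Defs
  imports "HOL-Analysis.Analysis"
begin

section \<open>The Hilbert space of square-summable complex sequences\<close>

lemma square_summable_add:
  fixes x y :: "nat \<Rightarrow> complex"
  assumes "summable (\<lambda>n. (cmod (x n))\<^sup>2)" "summable (\<lambda>n. (cmod (y n))\<^sup>2)"
  shows "summable (\<lambda>n. (cmod (x n + y n))\<^sup>2)"
proof (rule summable_comparison_test')
  show "summable (\<lambda>n. 2 * (cmod (x n))\<^sup>2 + 2 * (cmod (y n))\<^sup>2)"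
    by (intro summable_add summable_mult assms)
  fix n
  have "(cmod (x n + y n))\<^sup>2 \<le> (cmod (x n) + cmod (y n))\<^sup>2"
    by (intro power_mono norm_triangle_ineq) auto
  also have "\<dots> \<le> 2 * (cmod (x n))\<^sup>2 + 2 * (cmod (y n))\<^sup>2"
    using zero_le_power2[of "cmod (x n) - cmod (y n)"]
    by (simp add: power2_eq_square algebra_simps)
  finally show "norm ((cmod (x n + y n))\<^sup>2) \<le> 2 * (cmod (x n))\<^sup>2 + 2 * (cmod (y n))\<^sup>2"
    by simp
qed

lemma square_summable_mult:
  fixes d x :: "nat \<Rightarrow> complex"
  assumes "bounded (range d)" "summable (\<lambda>n. (cmod (x n))\<^sup>2)"
  shows "summable (\<lambda>n. (cmod (d n * x n))\<^sup>2)"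
proof -
  obtain B where B: "\<And>n. cmod (d n) \<le> B"
    using assms(1) by (auto simp: bounded_iff)
  show ?thesis
  proof (rule summable_comparison_test')
    show "summable (\<lambda>n. B\<^sup>2 * (cmod (x n))\<^sup>2)"
      by (intro summable_mult assms)
    show "norm ((cmod (d n * x n))\<^sup>2) \<le> B\<^sup>2 * (cmod (x n))\<^sup>2" for n
      using power_mono[OF B[of n], of 2]
      by (simp add: norm_mult power_mult_distrib mult_right_mono)
  qed
qed

typedef ell2 = "{x :: nat \<Rightarrow> complex. summable (\<lambda>n. (cmod (x n))\<^sup>2)}"
  morphisms ell2_nth Abs_ell2
  by (rule exI[of _ "\<lambda>_. 0"]) simp

setup_lifting type_definition_ell2

lemma ell2_nth_square_summable: "summable (\<lambda>n. (cmod (ell2_nth x n))\<^sup>2)"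
  using ell2_nth[of x] by simp

lemma ell2_eqI: "(\<And>n. ell2_nth x n = ell2_nth y n) \<Longrightarrow> x = y"
  by (simp add: ell2_nth_inject[symmetric] fun_eq_iff)

instantiation ell2 :: real_vector
begin

lift_definition zero_ell2 :: ell2 is "\<lambda>_. 0" by simp

lift_definition plus_ell2 :: "ell2 \<Rightarrow> ell2 \<Rightarrow> ell2" is "\<lambda>x y n. x n + y n"
  by (rule square_summable_add)

lift_definition uminus_ell2 :: "ell2 \<Rightarrow> ell2" is "\<lambda>x n. - x n" by simp

lift_definition minus_ell2 :: "ell2 \<Rightarrow> ell2 \<Rightarrow> ell2" is "\<lambda>x y n. x n - y n"
  subgoal for x y using square_summable_add[of x "\<lambda>n. - y n"] by simp
  done

lift_definition scaleR_ell2 :: "real \<Rightarrow> ell2 \<Rightarrow> ell2" is "\<lambda>r x n. r *\<^sub>R x n"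
  by (simp add: power_mult_distrib summable_mult)

instance
  by standard (transfer; simp add: fun_eq_iff algebra_simps)+

end

lift_definition scaleC_ell2 :: "complex \<Rightarrow> ell2 \<Rightarrow> ell2" is "\<lambda>c x n. c * x n"
  by (simp add: norm_mult power_mult_distrib summable_mult)

text \<open>The inner product is linear in the first argument.\<close>

definition cinner :: "ell2 \<Rightarrow> ell2 \<Rightarrow> complex" where
  "cinner x y = (\<Sum>n. ell2_nth x n * cnj (ell2_nth y n))"

lemma cinner_abs_summable: "summable (\<lambda>n. cmod (ell2_nth x n * cnj (ell2_nth y n)))"
proof (rule summable_comparison_test')
  show "summable (\<lambda>n. (cmod (ell2_nth x n))\<^sup>2 + (cmod (ell2_nth y n))\<^sup>2)"
    by (intro summable_add ell2_nth_square_summable)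
  show "norm (cmod (ell2_nth x n * cnj (ell2_nth y n)))
      \<le> (cmod (ell2_nth x n))\<^sup>2 + (cmod (ell2_nth y n))\<^sup>2" for n
    using sum_squares_bound[of "cmod (ell2_nth x n)" "cmod (ell2_nth y n)"]
      mult_nonneg_nonneg[OF norm_ge_zero[of "ell2_nth x n"] norm_ge_zero[of "ell2_nth y n"]]
    by (simp only: norm_mult complex_mod_cnj real_norm_def abs_mult abs_norm_cancel)
qed

lemma cinner_summable: "summable (\<lambda>n. ell2_nth x n * cnj (ell2_nth y n))"
  using cinner_abs_summable by (rule summable_norm_cancel)

lemma cinner_commute: "cinner x y = cnj (cinner y x)"
  unfolding cinner_def
  using bounded_linear.suminf[OF bounded_linear_cnj cinner_summable[of y x]]
  by (simp add: mult.commute)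

lemma cinner_add_left: "cinner (x + y) z = cinner x z + cinner y z"
  unfolding cinner_def
  by (simp add: suminf_add[OF cinner_summable cinner_summable] plus_ell2.rep_eq algebra_simps)

lemma cinner_scaleC_left: "cinner (scaleC_ell2 c x) y = c * cinner x y"
  unfolding cinner_def
  by (simp add: suminf_mult[OF cinner_summable] scaleC_ell2.rep_eq mult.assoc)

lemma scaleR_ell2_scaleC: "r *\<^sub>R x = scaleC_ell2 (complex_of_real r) x" for x :: ell2
  by transfer (simp add: scaleR_conv_of_real)

lemma Re_cinner_same: "Re (cinner x x) = (\<Sum>n. (cmod (ell2_nth x n))\<^sup>2)"
  unfolding cinner_def Re_suminf[OF cinner_summable]
  by (simp add: cmod_power2) (simp add: power2_eq_square)

instantiation ell2 :: real_inner
begin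

definition inner_ell2 :: "ell2 \<Rightarrow> ell2 \<Rightarrow> real" where
  "inner_ell2 x y = Re (cinner x y)"

definition norm_ell2 :: "ell2 \<Rightarrow> real" where
  "norm_ell2 x = sqrt (\<Sum>n. (cmod (ell2_nth x n))\<^sup>2)"

definition sgn_ell2 :: "ell2 \<Rightarrow> ell2" where
  "sgn_ell2 x = x /\<^sub>R norm x"

definition dist_ell2 :: "ell2 \<Rightarrow> ell2 \<Rightarrow> real" where
  "dist_ell2 x y = norm (x - y)"

definition uniformity_ell2 :: "(ell2 \<times> ell2) filter" where
  "uniformity_ell2 = (INF e\<in>{0 <..}. principal {(x, y). dist x y < e})"

definition open_ell2 :: "ell2 set \<Rightarrow> bool" where
  "open_ell2 S = (\<forall>x\<in>S. \<forall>\<^sub>F (x', y) in uniformity. x' = x \<longrightarrow> y \<in> S)"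

instance
proof
  fix x y z :: ell2 and r :: real
  show "inner x y = inner y x"
    unfolding inner_ell2_def by (subst cinner_commute) simp
  show "inner (x + y) z = inner x z + inner y z"
    by (simp add: inner_ell2_def cinner_add_left)
  show "inner (r *\<^sub>R x) y = r * inner x y"
    by (simp add: inner_ell2_def scaleR_ell2_scaleC cinner_scaleC_left)
  show "0 \<le> inner x x"
    by (simp add: inner_ell2_def Re_cinner_same suminf_nonneg ell2_nth_square_summable)
  show "inner x x = 0 \<longleftrightarrow> x = 0"
  proof -
    have "inner x x = 0 \<longleftrightarrow> (\<forall>n. (cmod (ell2_nth x n))\<^sup>2 = 0)"
      unfolding inner_ell2_def Re_cinner_same
      by (rule suminf_eq_zero_iff[OF ell2_nth_square_summable]) simp
    also have "\<dots> \<longleftrightarrow> x = 0"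
      by transfer (simp add: fun_eq_iff)
    finally show ?thesis .
  qed
  show "norm x = sqrt (inner x x)"
    by (simp add: norm_ell2_def inner_ell2_def Re_cinner_same)
qed (simp_all add: sgn_ell2_def dist_ell2_def uniformity_ell2_def open_ell2_def)

end

lemma cinner_same: "cinner x x = complex_of_real ((norm x)\<^sup>2)"
proof -
  have "Im (cinner x x) = 0"
    using arg_cong[OF cinner_commute[of x x], of Im] by simp
  then show ?thesis
    by (simp add: complex_eq_iff power2_norm_eq_inner inner_ell2_def)
qed

lemma norm_scaleC_ell2: "norm (scaleC_ell2 c x) = cmod c * norm x"
  by (simp add: norm_ell2_def scaleC_ell2.rep_eq norm_mult power_mult_distrib
      suminf_mult[OF ell2_nth_square_summable] real_sqrt_mult)

lemma scaleC_ell2_simps: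
  "scaleC_ell2 c (x + y) = scaleC_ell2 c x + scaleC_ell2 c y"
  "scaleC_ell2 c (x - y) = scaleC_ell2 c x - scaleC_ell2 c y"
  "scaleC_ell2 c (- x) = - scaleC_ell2 c x"
  "scaleC_ell2 c 0 = 0"
  "scaleC_ell2 c (r *\<^sub>R x) = r *\<^sub>R scaleC_ell2 c x"
  "scaleC_ell2 (c + d) x = scaleC_ell2 c x + scaleC_ell2 d x"
  "scaleC_ell2 c (scaleC_ell2 d x) = scaleC_ell2 (c * d) x"
  "scaleC_ell2 1 x = x"
  by (transfer; simp add: fun_eq_iff algebra_simps scaleR_conv_of_real)+

lift_definition ell2_basis :: "nat \<Rightarrow> ell2" is "\<lambda>j n. if n = j then 1 else 0"
  subgoal for j
    by (rule summable_finite[of "{j}"]) auto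
  done

lemma cinner_basis_right: "cinner x (ell2_basis i) = ell2_nth x i"
  unfolding cinner_def
  by (subst suminf_finite[of "{i}"]) (auto simp: ell2_basis.rep_eq)

text \<open>For a bounded sequence \<open>d\<close>, the operator of multiplication by \<open>d\<close>; the value for unbounded
  \<open>d\<close> is a dummy.\<close>

lift_definition mult_ell2 :: "(nat \<Rightarrow> complex) \<Rightarrow> ell2 \<Rightarrow> ell2"
  is "\<lambda>d x n. if bounded (range d) then d n * x n else 0"
  subgoal for d x using square_summable_mult[of d x] by (cases "bounded (range d)") simp_all
  done

lemma bounded_linear_mult_ell2: "bounded_linear (mult_ell2 d)"
proof (cases "bounded (range d)")
  case True
  then obtain B where B: "\<And>n. cmod (d n) \<le> B"
    by (auto simp: bounded_iff)
  have B0: "0 \<le> B" using norm_ge_zero B[of 0] by (rule order_trans)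
  have "norm (mult_ell2 d x) \<le> norm x * B" for x
  proof -
    have "(\<Sum>n. (cmod (ell2_nth (mult_ell2 d x) n))\<^sup>2) \<le> (\<Sum>n. B\<^sup>2 * (cmod (ell2_nth x n))\<^sup>2)"
    proof (rule suminf_le)
      show "(cmod (ell2_nth (mult_ell2 d x) n))\<^sup>2 \<le> B\<^sup>2 * (cmod (ell2_nth x n))\<^sup>2" for n
        using True power_mono[OF B[of n], of 2]
        by (simp add: mult_ell2.rep_eq norm_mult power_mult_distrib mult_right_mono)
    qed (intro summable_mult ell2_nth_square_summable)+
    then have "norm (mult_ell2 d x) \<le> sqrt (B\<^sup>2 * (\<Sum>n. (cmod (ell2_nth x n))\<^sup>2))"
      by (simp add: norm_ell2_def suminf_mult[OF ell2_nth_square_summable])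
    then show ?thesis
      using B0 by (simp add: norm_ell2_def real_sqrt_mult mult.commute)
  qed
  moreover have "mult_ell2 d (x + y) = mult_ell2 d x + mult_ell2 d y"
    and "mult_ell2 d (r *\<^sub>R x) = r *\<^sub>R mult_ell2 d x" for x y r
    by (transfer; simp add: fun_eq_iff algebra_simps)+
  ultimately show ?thesis by (intro bounded_linear_intro[of _ B])
next
  case False
  then have "mult_ell2 d = (\<lambda>_. 0)"
    by (intro ext ell2_eqI) (simp add: mult_ell2.rep_eq zero_ell2.rep_eq)
  then show ?thesis by simp
qed

lemma mult_ell2_scaleC: "mult_ell2 d (scaleC_ell2 c x) = scaleC_ell2 c (mult_ell2 d x)"
  by transfer (simp add: fun_eq_iff)


section \<open>Bounded operators\<close>

lifting_forget ell2.lifting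

typedef ell2_op = "{T :: ell2 \<Rightarrow>\<^sub>L ell2. \<forall>c x. T (scaleC_ell2 c x) = scaleC_ell2 c (T x)}"
  morphisms blinfun_of_op Abs_ell2_op
  by (rule exI[of _ id_blinfun]) simp

setup_lifting type_definition_ell2_op

lift_definition op_apply :: "ell2_op \<Rightarrow> ell2 \<Rightarrow> ell2" is blinfun_apply .

lemma ell2_op_eqI: "(\<And>x. op_apply S x = op_apply T x) \<Longrightarrow> S = T"
  by transfer (rule blinfun_eqI)

instantiation ell2_op :: real_normed_algebra_1
begin

lift_definition zero_ell2_op :: ell2_op is 0
  by (simp add: scaleC_ell2_simps)

lift_definition one_ell2_op :: ell2_op is id_blinfun
  by simp

lift_definition plus_ell2_op :: "ell2_op \<Rightarrow> ell2_op \<Rightarrow> ell2_op" is "(+)"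
  by (simp add: blinfun.add_left scaleC_ell2_simps)

lift_definition uminus_ell2_op :: "ell2_op \<Rightarrow> ell2_op" is uminus
  by (simp add: blinfun.minus_left scaleC_ell2_simps)

lift_definition minus_ell2_op :: "ell2_op \<Rightarrow> ell2_op \<Rightarrow> ell2_op" is "(-)"
  by (simp add: blinfun.diff_left scaleC_ell2_simps)

lift_definition scaleR_ell2_op :: "real \<Rightarrow> ell2_op \<Rightarrow> ell2_op" is scaleR
  by (simp add: blinfun.scaleR_left scaleC_ell2_simps)

lift_definition times_ell2_op :: "ell2_op \<Rightarrow> ell2_op \<Rightarrow> ell2_op" is blinfun_compose
  by simp

lift_definition norm_ell2_op :: "ell2_op \<Rightarrow> real" is norm .

definition sgn_ell2_op :: "ell2_op \<Rightarrow> ell2_op" where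
  "sgn_ell2_op x = inverse (norm x) *\<^sub>R x"

definition dist_ell2_op :: "ell2_op \<Rightarrow> ell2_op \<Rightarrow> real" where
  "dist_ell2_op x y = norm (x - y)"

definition uniformity_ell2_op :: "(ell2_op \<times> ell2_op) filter" where
  "uniformity_ell2_op = (INF e\<in>{0 <..}. principal {(x, y). dist x y < e})"

definition open_ell2_op :: "ell2_op set \<Rightarrow> bool" where
  "open_ell2_op S = (\<forall>x\<in>S. \<forall>\<^sub>F (x', y) in uniformity. x' = x \<longrightarrow> y \<in> S)"

instance
proof
  fix a b c :: ell2_op and r s :: real
  show "a + b + c = a + (b + c)" by transfer simp
  show "a + b = b + a" by transfer simp
  show "0 + a = a" by transfer simp
  show "- a + a = 0" by transfer simp
  show "a - b = a + - b" by transfer simp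
  show "r *\<^sub>R (a + b) = r *\<^sub>R a + r *\<^sub>R b" by transfer (simp add: scaleR_add_right)
  show "(r + s) *\<^sub>R a = r *\<^sub>R a + s *\<^sub>R a" by transfer (simp add: scaleR_add_left)
  show "r *\<^sub>R s *\<^sub>R a = (r * s) *\<^sub>R a" by transfer simp
  show "1 *\<^sub>R a = a" by transfer simp
  show "a * b * c = a * (b * c)" by transfer (simp add: blinfun_eqI)
  show "(a + b) * c = a * c + b * c"
    by transfer (simp add: blinfun_eqI blinfun.add_left)
  show "a * (b + c) = a * b + a * c"
    by transfer (simp add: blinfun_eqI blinfun.add_left blinfun.add_right)
  show "r *\<^sub>R a * b = r *\<^sub>R (a * b)"
    by transfer (simp add: blinfun_eqI blinfun.scaleR_left)
  show "a * r *\<^sub>R b = r *\<^sub>R (a * b)"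
    by transfer (simp add: blinfun_eqI blinfun.scaleR_left blinfun.scaleR_right)
  show "1 * a = a" by transfer (simp add: blinfun_eqI)
  show "a * 1 = a" by transfer (simp add: blinfun_eqI)
  show "norm a = 0 \<longleftrightarrow> a = 0" by transfer simp
  show "norm (a + b) \<le> norm a + norm b" by transfer (rule norm_triangle_ineq)
  show "norm (r *\<^sub>R a) = \<bar>r\<bar> * norm a" by transfer simp
  show "norm (a * b) \<le> norm a * norm b" by transfer (rule norm_blinfun_compose)
  have "ell2_nth (ell2_basis 0) 0 \<noteq> ell2_nth 0 0"
    by (simp add: ell2_basis.rep_eq zero_ell2.rep_eq)
  then have nz: "ell2_basis 0 \<noteq> 0" by metis
  have le: "norm (id_blinfun :: ell2 \<Rightarrow>\<^sub>L ell2) \<le> 1"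
    by (rule norm_blinfun_bound) auto
  have "norm (ell2_basis 0) \<le> norm (id_blinfun :: ell2 \<Rightarrow>\<^sub>L ell2) * norm (ell2_basis 0)"
    using norm_blinfun[of "id_blinfun :: ell2 \<Rightarrow>\<^sub>L ell2" "ell2_basis 0"] by simp
  with nz le have "norm (id_blinfun :: ell2 \<Rightarrow>\<^sub>L ell2) = 1" by simp
  then show "norm (1 :: ell2_op) = 1" by transfer
  show "(0 :: ell2_op) \<noteq> 1"
  proof
    assume "(0 :: ell2_op) = 1"
    then have "(0 :: ell2 \<Rightarrow>\<^sub>L ell2) = id_blinfun" by transfer
    from arg_cong[OF this, of "\<lambda>f. blinfun_apply f (ell2_basis 0)"]
    have "ell2_basis 0 = 0" by simp
    with nz show False by simp
  qed
qed (simp_all add: sgn_ell2_op_def dist_ell2_op_def uniformity_ell2_op_def open_ell2_op_def)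

end

lemma norm_ell2_op_eq_onorm: "norm T = onorm (op_apply T)"
  by (simp add: norm_ell2_op.rep_eq norm_blinfun.rep_eq op_apply.rep_eq)

lemma bounded_linear_scaleC_ell2: "bounded_linear (scaleC_ell2 c)"
  by (rule bounded_linear_intro[of _ "cmod c"])
     (simp_all add: scaleC_ell2_simps norm_scaleC_ell2)

lift_definition scaleC_op :: "complex \<Rightarrow> ell2_op \<Rightarrow> ell2_op"
  is "\<lambda>c T. Blinfun (scaleC_ell2 c) o\<^sub>L T"
  by (simp add: bounded_linear_Blinfun_apply bounded_linear_scaleC_ell2 scaleC_ell2_simps
      mult.commute)

lemma op_apply_scaleC_op: "op_apply (scaleC_op c T) x = scaleC_ell2 c (op_apply T x)"
  by transfer (simp add: bounded_linear_Blinfun_apply bounded_linear_scaleC_ell2)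

lemma op_apply_simps:
  "op_apply (S + T) x = op_apply S x + op_apply T x"
  "op_apply (S * T) x = op_apply S (op_apply T x)"
  "op_apply 1 x = x"
  "op_apply 0 x = 0"
  by (transfer; simp add: blinfun.add_left)+

global_interpretation ell2_op: vector_space scaleC_op
  by standard (rule ell2_op_eqI; simp add: op_apply_scaleC_op op_apply_simps scaleC_ell2_simps)+

definition op_adj :: "ell2_op \<Rightarrow> ell2_op" where
  "op_adj T = (THE S. \<forall>x y. cinner (op_apply T x) y = cinner x (op_apply S y))"

lemma cinner_add_right: "cinner x (y + z) = cinner x y + cinner x z"
  using cinner_add_left[of y z x] cinner_commute[of x y] cinner_commute[of x z]
    cinner_commute[of x "y + z"] by simp

lemma cinner_scaleC_right: "cinner x (scaleC_ell2 c y) = cnj c * cinner x y"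
  using cinner_scaleC_left[of c y x] cinner_commute[of x y]
    cinner_commute[of x "scaleC_ell2 c y"] by simp

lemma cinner_zero_left: "cinner 0 y = 0"
  using cinner_add_left[of 0 0 y] by simp

lemma cinner_sum_left: "cinner (\<Sum>i\<in>A. f i) y = (\<Sum>i\<in>A. cinner (f i) y)"
  by (induction A rule: infinite_finite_induct) (simp_all add: cinner_zero_left cinner_add_left)

lemma cinner_Cauchy_Schwarz: "cmod (cinner x y) \<le> norm x * norm y"
proof (cases "cinner x y = 0")
  case False
  define c where "c = cnj (cinner x y) / complex_of_real (cmod (cinner x y))"
  have c: "cmod c = 1" using False by (simp add: c_def norm_divide)
  have "c * cinner x y = complex_of_real (cmod (cinner x y))"
    using False complex_norm_square[of "cinner x y"]
    by (simp add: c_def field_simps power2_eq_square)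
  then have "cmod (cinner x y) = inner (scaleC_ell2 c x) y"
    by (simp add: inner_ell2_def cinner_scaleC_left)
  also have "\<dots> \<le> norm (scaleC_ell2 c x) * norm y"
    by (rule norm_cauchy_schwarz)
  finally show ?thesis by (simp add: norm_scaleC_ell2 c)
qed simp

lemma norm_op_apply_le: "norm (op_apply T x) \<le> norm T * norm x"
  by transfer (rule norm_blinfun)

lemma bounded_linear_op_apply: "bounded_linear (op_apply T)"
  by transfer (rule blinfun.bounded_linear_right)

lemma op_apply_scaleC: "op_apply T (scaleC_ell2 c x) = scaleC_ell2 c (op_apply T x)"
  by transfer simp

definition ell2_trunc :: "nat \<Rightarrow> (nat \<Rightarrow> complex) \<Rightarrow> ell2" where
  "ell2_trunc n a = (\<Sum>j<n. scaleC_ell2 (a j) (ell2_basis j))"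

lemma ell2_nth_sum: "ell2_nth (\<Sum>i\<in>A. f i) k = (\<Sum>i\<in>A. ell2_nth (f i) k)"
  by (induction A rule: infinite_finite_induct) (simp_all add: zero_ell2.rep_eq plus_ell2.rep_eq)

lemma ell2_nth_trunc: "ell2_nth (ell2_trunc n a) k = (if k < n then a k else 0)"
proof -
  have "ell2_nth (ell2_trunc n a) k = (\<Sum>j<n. if k = j then a j else 0)"
    unfolding ell2_trunc_def ell2_nth_sum
    by (rule sum.cong) (simp_all add: scaleC_ell2.rep_eq ell2_basis.rep_eq)
  also have "\<dots> = (if k < n then a k else 0)" by (subst sum.delta') auto
  finally show ?thesis .
qed

lemma norm_ell2_power2: "(norm x)\<^sup>2 = (\<Sum>n. (cmod (ell2_nth x n))\<^sup>2)"
  by (simp add: norm_ell2_def suminf_nonneg ell2_nth_square_summable)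

lemma norm_ell2_trunc: "(norm (ell2_trunc n a))\<^sup>2 = (\<Sum>j<n. (cmod (a j))\<^sup>2)"
  unfolding norm_ell2_power2
  by (subst suminf_finite[of "{..<n}"]) (auto simp: ell2_nth_trunc)

lemma ell2_trunc_tendsto: "(\<lambda>n. ell2_trunc n (ell2_nth x)) \<longlonglongrightarrow> x"
proof -
  let ?f = "\<lambda>k. (cmod (ell2_nth x k))\<^sup>2"
  have eq: "(norm (ell2_trunc n (ell2_nth x) - x))\<^sup>2 = suminf ?f - sum ?f {..<n}" for n
  proof -
    have "(norm (ell2_trunc n (ell2_nth x) - x))\<^sup>2 = (\<Sum>k. if k < n then 0 else ?f k)"
      unfolding norm_ell2_power2 by (rule suminf_cong) (simp add: minus_ell2.rep_eq ell2_nth_trunc)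
    also have "\<dots> = (\<Sum>k. ?f k - (if k \<in> {..<n} then ?f k else 0))"
      by (rule suminf_cong) simp
    also have "\<dots> = suminf ?f - (\<Sum>k. if k \<in> {..<n} then ?f k else 0)"
      by (intro suminf_diff[symmetric] ell2_nth_square_summable summable_If_finite_set) simp
    also have "(\<Sum>k. if k \<in> {..<n} then ?f k else 0) = sum ?f {..<n}"
      by (subst suminf_finite[of "{..<n}"]) auto
    finally show ?thesis .
  qed
  have "(\<lambda>n. suminf ?f - sum ?f {..<n}) \<longlonglongrightarrow> suminf ?f - suminf ?f"
    by (intro tendsto_intros summable_LIMSEQ ell2_nth_square_summable)
  then have "(\<lambda>n. sqrt ((norm (ell2_trunc n (ell2_nth x) - x))\<^sup>2)) \<longlonglongrightarrow> sqrt 0"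
    unfolding eq by (intro tendsto_real_sqrt) simp
  then have "(\<lambda>n. norm (ell2_trunc n (ell2_nth x) - x)) \<longlonglongrightarrow> 0"
    by simp
  then show ?thesis
    using LIM_zero_cancel tendsto_norm_zero_iff by blast
qed

lemma cinner_op_apply_trunc:
  "cinner (op_apply T (ell2_trunc n a)) y = (\<Sum>j<n. a j * cinner (op_apply T (ell2_basis j)) y)"
  by (simp add: ell2_trunc_def linear_sum[OF bounded_linear.linear[OF bounded_linear_op_apply]]
      op_apply_scaleC cinner_sum_left cinner_scaleC_left)

lemma ell2_op_ex_adj: "\<exists>S. \<forall>x y. cinner (op_apply T x) y = cinner x (op_apply S y)"
proof -
  define a where "a y j = cnj (cinner (op_apply T (ell2_basis j)) y)" for y j
  have partial: "(\<Sum>j<n. (cmod (a y j))\<^sup>2) \<le> (norm T * norm y)\<^sup>2" for n y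
  proof -
    let ?z = "ell2_trunc n (a y)"
    have "cinner (op_apply T ?z) y = complex_of_real (\<Sum>j<n. (cmod (a y j))\<^sup>2)"
      unfolding cinner_op_apply_trunc
      by (simp add: a_def mult.commute flip: complex_norm_square)
    then have "(norm ?z)\<^sup>2 = cmod (cinner (op_apply T ?z) y)"
      by (simp add: norm_ell2_trunc sum_nonneg del: of_real_sum)
    also have "\<dots> \<le> norm T * norm ?z * norm y"
      by (rule order_trans[OF cinner_Cauchy_Schwarz mult_right_mono[OF norm_op_apply_le]]) simp
    finally have "norm ?z * norm ?z \<le> norm ?z * (norm T * norm y)"
      by (simp add: power2_eq_square mult_ac)
    then have "norm ?z \<le> norm T * norm y"
      by (cases "norm ?z = 0") simp_all
    then show ?thesis
      unfolding norm_ell2_trunc[symmetric] by (intro power_mono) auto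
  qed
  have summ: "summable (\<lambda>j. (cmod (a y j))\<^sup>2)" for y
    using partial by (intro summableI_nonneg_bounded[where x = "(norm T * norm y)\<^sup>2"]) auto
  define S where "S y = Abs_ell2 (a y)" for y
  have nth_S: "ell2_nth (S y) = a y" for y
    unfolding S_def using summ by (intro Abs_ell2_inverse) simp
  have S_bound: "norm (S y) \<le> norm y * norm T" for y
  proof -
    have "(norm (S y))\<^sup>2 \<le> (norm T * norm y)\<^sup>2"
      unfolding norm_ell2_power2 nth_S by (intro suminf_le_const summ partial)
    then show ?thesis
      by (simp add: power2_le_iff_abs_le mult.commute)
  qed
  have S_add: "S (x + y) = S x + S y" for x y
    by (rule ell2_eqI) (simp add: nth_S a_def plus_ell2.rep_eq cinner_add_right)
  have S_scaleC: "S (scaleC_ell2 c x) = scaleC_ell2 c (S x)" for c x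
    by (rule ell2_eqI) (simp add: nth_S a_def scaleC_ell2.rep_eq cinner_scaleC_right)
  have "bounded_linear S"
    by (intro bounded_linear_intro[of _ "norm T"] S_bound S_add)
       (simp add: scaleR_ell2_scaleC S_scaleC)
  then have app: "op_apply (Abs_ell2_op (Blinfun S)) y = S y" for y
    by (simp add: op_apply.rep_eq Abs_ell2_op_inverse bounded_linear_Blinfun_apply S_scaleC)
  have "cinner (op_apply T x) y = cinner x (S y)" for x y
  proof -
    let ?g = "\<lambda>n. cinner (op_apply T (ell2_trunc n (ell2_nth x))) y"
    have cont: "bounded_linear (\<lambda>z. cinner z y)"
      by (rule bounded_linear_intro[of _ "norm y"])
         (simp_all add: cinner_add_left scaleR_ell2_scaleC cinner_scaleC_left
           cinner_Cauchy_Schwarz scaleR_conv_of_real)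
    have "?g \<longlonglongrightarrow> cinner (op_apply T x) y"
      by (intro bounded_linear.tendsto[OF cont] bounded_linear.tendsto[OF bounded_linear_op_apply]
          ell2_trunc_tendsto)
    moreover have "?g \<longlonglongrightarrow> cinner x (S y)"
      unfolding cinner_op_apply_trunc cinner_def[of x "S y"]
      using summable_LIMSEQ[OF cinner_summable[of x "S y"]] by (simp add: nth_S a_def)
    ultimately show ?thesis by (rule LIMSEQ_unique)
  qed
  then show ?thesis using app by metis
qed

lemma op_adj_unique:
  assumes "\<And>x y. cinner (op_apply T x) y = cinner x (op_apply S y)"
  shows "op_adj T = S"
  unfolding op_adj_def
proof (rule the_equality)
  fix R assume R: "\<forall>x y. cinner (op_apply T x) y = cinner x (op_apply R y)"
  show "R = S"
  proof (intro ell2_op_eqI ell2_eqI)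
    fix y n
    have "cinner (ell2_basis n) (op_apply R y) = cinner (ell2_basis n) (op_apply S y)"
      using R assms by simp
    then show "ell2_nth (op_apply R y) n = ell2_nth (op_apply S y) n"
      using cinner_commute[of "ell2_basis n"] by (simp add: cinner_basis_right)
  qed
qed (use assms in blast)

lemma op_adj: "cinner (op_apply T x) y = cinner x (op_apply (op_adj T) y)"
  using ell2_op_ex_adj[of T] op_adj_unique[of T] by metis

definition op_matrix :: "ell2_op \<Rightarrow> nat \<Rightarrow> nat \<Rightarrow> complex" where
  "op_matrix T i j = cinner (op_apply T (ell2_basis j)) (ell2_basis i)"

lift_definition diag_op :: "(nat \<Rightarrow> complex) \<Rightarrow> ell2_op" is "\<lambda>d. Blinfun (mult_ell2 d)"
  by (simp add: bounded_linear_Blinfun_apply bounded_linear_mult_ell2 mult_ell2_scaleC)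

lemma ell2_nth_diag_op:
  assumes "bounded (range d)"
  shows "ell2_nth (op_apply (diag_op d) x) n = d n * ell2_nth x n"
  using assms
  by (simp add: op_apply.rep_eq diag_op.rep_eq bounded_linear_Blinfun_apply
      bounded_linear_mult_ell2 mult_ell2.rep_eq)

definition diag_proj :: "nat set \<Rightarrow> ell2_op" where
  "diag_proj I = diag_op (indicator I)"

definition char_matrix :: "(nat \<times> nat) set \<Rightarrow> nat \<Rightarrow> nat \<Rightarrow> complex" where
  "char_matrix E i j = indicator E (i, j)"

definition schur_mult ::
    "(nat \<Rightarrow> nat \<Rightarrow> complex) \<Rightarrow> (nat \<Rightarrow> nat \<Rightarrow> complex) \<Rightarrow> nat \<Rightarrow> nat \<Rightarrow> complex" where
  "schur_mult A X i j = A i j * X i j"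

text \<open>\<open>\<Phi> = S\<^sub>A\<close> as a map on bounded operators; in particular the Schur product of \<open>A\<close> with the
  matrix of a bounded operator is again the matrix of a bounded operator.\<close>

definition is_schur_multiplication ::
    "(ell2_op \<Rightarrow> ell2_op) \<Rightarrow> (nat \<Rightarrow> nat \<Rightarrow> complex) \<Rightarrow> bool" where
  "is_schur_multiplication \<Phi> A \<longleftrightarrow> (\<forall>T. op_matrix (\<Phi> T) = schur_mult A (op_matrix T))"


section \<open>The weak* topology\<close>

text \<open>The predual of the bounded operators is the space of trace class operators, which are the
  sums of rank one operators \<open>\<Sum>k. \<langle>\<sqdot>, y k\<rangle> x k\<close> with square-summable sequences of vectors;
  the pairing with such an operator is \<open>T \<mapsto> \<Sum>k. \<langle>T (x k), y k\<rangle>\<close>.\<close>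

definition weak_star_functionals :: "(ell2_op \<Rightarrow> complex) set" where
  "weak_star_functionals = {\<lambda>T. \<Sum>k. cinner (op_apply T (x k)) (y k) | x y.
     summable (\<lambda>k. (norm (x k))\<^sup>2) \<and> summable (\<lambda>k. (norm (y k :: ell2))\<^sup>2)}"

definition weak_star_topology :: "ell2_op topology" where
  "weak_star_topology =
     topology_generated_by {\<phi> -` U | \<phi> U. \<phi> \<in> weak_star_functionals \<and> open U}"

lemma topspace_weak_star_topology [simp]: "topspace weak_star_topology = UNIV"
proof -
  have "(\<lambda>T. \<Sum>k. cinner (op_apply T ((\<lambda>_. 0) k)) ((\<lambda>_. 0) k)) \<in> weak_star_functionals"
    unfolding weak_star_functionals_def by (intro CollectI exI conjI) (auto simp: fun_eq_iff)
  then show ?thesis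
    unfolding weak_star_topology_def topology_generated_by_topspace
    using open_UNIV by blast
qed

definition weak_star_closed_sum :: "(nat \<Rightarrow> ell2_op set) \<Rightarrow> ell2_op set" where
  "weak_star_closed_sum V = weak_star_topology closure_of ell2_op.span (\<Union>m. V m)"

end

theory Submission
  imports Defs
begin

text \<open>
  A bimodule map commutes with cutting an operator down to a single matrix entry, so it acts on
  each entry separately: it is Schur multiplication by a fixed matrix. If the map is idempotent,
  the entries of that matrix are idempotent complex numbers, and what remains is a pattern
  \<open>E \<subseteq> \<nat> \<times> \<nat>\<close>, the question being which patterns have small norm.

  The constant \<open>2 / sqrt 3\<close> is the norm of Schur multiplication by the two by two matrix with
  three entries \<open>1\<close> and one entry \<open>0\<close>; it is attained at the unitary \<open>(a, b; b, -a)\<close> with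
  \<open>a = 1 / sqrt 3\<close> and \<open>b = sqrt 2 / sqrt 3\<close>. Below that norm no two rows and two columns of \<open>E\<close>
  can show exactly three entries (\<open>difunctional_if_norm_less\<close>). This means that two rows of \<open>E\<close>
  which meet are equal, and so \<open>E\<close> is a union of rectangles \<open>I m \<times> J m\<close> with disjoint
  rows and disjoint columns (\<open>difunctional_rectangles\<close>).

  The three claims then follow from the shape of \<open>E\<close>. The map has norm at most \<open>1\<close> because it
  sends \<open>T\<close> to the orthogonal direct sum of the corners of \<open>T\<close> on the rectangles
  (\<open>norm_rectangular_schur_idempotent_le\<close>). Its range consists of the operators whose matrix
  vanishes off \<open>E\<close>; this is weak* closed, and every such operator is the weak* limit of its
  finite compressions, which are finite combinations of matrix units lying in the corners
  (\<open>range_rectangular_schur_idempotent\<close>). The range is closed under \<open>(R, S, T) \<mapsto> R S* T\<close>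
  because the pattern satisfies the corresponding inclusion \<open>E O E\<inverse> O E \<subseteq> E\<close>
  (\<open>range_ternary_closed\<close>).
\<close>

section \<open>Matrix entries and diagonal projections\<close>

lemma op_matrix_eq_nth: "op_matrix T i j = ell2_nth (op_apply T (ell2_basis j)) i"
  by (simp add: op_matrix_def cinner_basis_right)

text \<open>Row \<open>i\<close> of the matrix of \<open>T\<close> is the conjugate of the vector \<open>T* e\<^sub>i\<close>, which is square
  summable; the series is the inner product of \<open>x\<close> with that vector.\<close>

lemma sums_op_apply: "(\<lambda>j. op_matrix T i j * ell2_nth x j) sums ell2_nth (op_apply T x) i"
proof -
  let ?y = "op_apply (op_adj T) (ell2_basis i)"
  have "op_matrix T i j = cnj (ell2_nth ?y j)" for j
    unfolding op_matrix_def op_adj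
    by (subst cinner_commute) (simp add: cinner_basis_right)
  moreover have "(\<lambda>j. ell2_nth x j * cnj (ell2_nth ?y j)) sums cinner x ?y"
    unfolding cinner_def by (intro summable_sums cinner_summable)
  moreover have "cinner x ?y = ell2_nth (op_apply T x) i"
    by (simp add: cinner_basis_right flip: op_adj)
  ultimately show ?thesis by (simp add: mult.commute)
qed

lemma nth_op_apply: "ell2_nth (op_apply T x) i = (\<Sum>j. op_matrix T i j * ell2_nth x j)"
  using sums_op_apply by (rule sums_unique)

lemma op_matrix_eqI:
  assumes "\<And>i j. op_matrix S i j = op_matrix T i j"
  shows "S = T"
  using assms by (intro ell2_op_eqI ell2_eqI) (simp add: nth_op_apply)

lemma op_matrix_add: "op_matrix (S + T) i j = op_matrix S i j + op_matrix T i j"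
  by (simp add: op_matrix_def op_apply_simps cinner_add_left)

lemma op_matrix_scaleC: "op_matrix (scaleC_op c T) i j = c * op_matrix T i j"
  by (simp add: op_matrix_def op_apply_scaleC_op cinner_scaleC_left)

lemma op_matrix_zero: "op_matrix 0 i j = 0"
  by (simp add: op_matrix_def op_apply_simps cinner_zero_left)

lemma op_matrix_sum: "op_matrix (\<Sum>a\<in>A. f a) i j = (\<Sum>a\<in>A. op_matrix (f a) i j)"
  by (induction A rule: infinite_finite_induct) (simp_all add: op_matrix_zero op_matrix_add)

lemma op_matrix_adj: "op_matrix (op_adj T) i j = cnj (op_matrix T j i)"
  unfolding op_matrix_def by (subst cinner_commute) (simp add: op_adj)

lemma bounded_range_indicator: "bounded (range (indicator S :: nat \<Rightarrow> complex))"
  by (rule boundedI[of _ 1]) (auto simp: indicator_def)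

lemma diag_op_basis:
  assumes "bounded (range d)"
  shows "op_apply (diag_op d) (ell2_basis j) = scaleC_ell2 (d j) (ell2_basis j)"
  by (rule ell2_eqI) (simp add: ell2_nth_diag_op[OF assms] scaleC_ell2.rep_eq ell2_basis.rep_eq)

lemma op_matrix_diag_op:
  assumes "bounded (range d1)" "bounded (range d2)"
  shows "op_matrix (diag_op d1 * T * diag_op d2) i j = d1 i * op_matrix T i j * d2 j"
  by (simp add: op_matrix_eq_nth op_apply_simps diag_op_basis[OF assms(2)] op_apply_scaleC
      scaleC_ell2.rep_eq ell2_nth_diag_op[OF assms(1)] mult_ac)

lemma op_matrix_diag_proj:
  "op_matrix (diag_proj I * T * diag_proj J) i j = (if i \<in> I \<and> j \<in> J then op_matrix T i j else 0)"
  unfolding diag_proj_def by (subst op_matrix_diag_op) (auto simp: bounded_range_indicator)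

lemma nth_diag_proj: "ell2_nth (op_apply (diag_proj S) x) n = indicator S n * ell2_nth x n"
  by (simp add: diag_proj_def ell2_nth_diag_op bounded_range_indicator)

lemma cmod_nth_diag_proj_power2:
  "(cmod (ell2_nth (op_apply (diag_proj S) x) n))\<^sup>2 = indicator S n * (cmod (ell2_nth x n))\<^sup>2"
  by (simp add: nth_diag_proj indicator_def)

lemma norm_diag_proj_power2:
  "(norm (op_apply (diag_proj S) x))\<^sup>2 = (\<Sum>n. indicator S n * (cmod (ell2_nth x n))\<^sup>2)"
  by (simp add: norm_ell2_power2 cmod_nth_diag_proj_power2)

lemma sum_nth_le_norm_power2: "finite A \<Longrightarrow> (\<Sum>n\<in>A. (cmod (ell2_nth x n))\<^sup>2) \<le> (norm x)\<^sup>2"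
  unfolding norm_ell2_power2 by (intro sum_le_suminf ell2_nth_square_summable) auto

lemma norm_diag_proj_le: "norm (op_apply (diag_proj S) x) \<le> norm x"
proof (rule power2_le_imp_le)
  show "(norm (op_apply (diag_proj S) x))\<^sup>2 \<le> (norm x)\<^sup>2"
    unfolding norm_ell2_power2
    by (intro suminf_le ell2_nth_square_summable)
       (simp add: cmod_nth_diag_proj_power2 indicator_def)
qed simp

lemma cmod_nth_le_norm: "cmod (ell2_nth x n) \<le> norm x"
  by (rule power2_le_imp_le) (use sum_nth_le_norm_power2[of "{n}" x] in simp_all)

lemma norm_op_le_of_power2:
  assumes "\<And>x. (norm (op_apply T x))\<^sup>2 \<le> (B * norm x)\<^sup>2" "0 \<le> B"
  shows "norm T \<le> B"
  unfolding norm_ell2_op_eq_onorm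
proof (rule onorm_bound[OF assms(2)])
  fix x
  show "norm (op_apply T x) \<le> B * norm x"
    using assms by (intro power2_le_imp_le[OF assms(1)]) simp
qed

lemma bounded_linear_rank_one:
  "bounded_linear (\<lambda>x. scaleC_ell2 (ell2_nth x j) (ell2_basis i))" (is "bounded_linear ?f")
proof (rule bounded_linear_intro[of _ "norm (ell2_basis i)"])
  show "norm (?f x) \<le> norm x * norm (ell2_basis i)" for x
    by (simp add: norm_scaleC_ell2 cmod_nth_le_norm mult_right_mono)
  show "?f (x + y) = ?f x + ?f y" for x y
    by (simp add: plus_ell2.rep_eq scaleC_ell2_simps)
  show "?f (r *\<^sub>R x) = r *\<^sub>R ?f x" for r x
    by (rule ell2_eqI) (simp add: scaleR_ell2.rep_eq scaleC_ell2.rep_eq)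
qed

lift_definition matrix_unit :: "nat \<Rightarrow> nat \<Rightarrow> ell2_op"
  is "\<lambda>i j. Blinfun (\<lambda>x. scaleC_ell2 (ell2_nth x j) (ell2_basis i))"
  by (simp add: bounded_linear_Blinfun_apply bounded_linear_rank_one scaleC_ell2.rep_eq
      scaleC_ell2_simps)

lemma op_apply_matrix_unit:
  "op_apply (matrix_unit i j) x = scaleC_ell2 (ell2_nth x j) (ell2_basis i)"
  by transfer (simp add: bounded_linear_Blinfun_apply bounded_linear_rank_one)

lemma op_matrix_unit: "op_matrix (matrix_unit i j) k l = (if k = i \<and> l = j then 1 else 0)"
  by (simp add: op_matrix_eq_nth op_apply_matrix_unit scaleC_ell2.rep_eq ell2_basis.rep_eq)

lemma diag_proj_singletons:
  "diag_proj {i} * T * diag_proj {j} = scaleC_op (op_matrix T i j) (matrix_unit i j)"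
  by (rule op_matrix_eqI) (simp add: op_matrix_diag_proj op_matrix_scaleC op_matrix_unit)

section \<open>Bimodule projections are Schur idempotents\<close>

text \<open>The entry at \<open>(i, j)\<close> is cut out by two diagonal projections. They can be moved through \<open>P\<close>,
  where they leave a multiple of one matrix unit.\<close>

lemma bimodule_map_is_schur_multiplication:
  assumes complex_linear: "\<And>c T. P (scaleC_op c T) = scaleC_op c (P T)"
    and bimodule: "\<And>d1 d2 T. bounded (range d1) \<Longrightarrow> bounded (range d2) \<Longrightarrow>
       P (diag_op d1 * T * diag_op d2) = diag_op d1 * P T * diag_op d2"
  shows "is_schur_multiplication P (\<lambda>i j. op_matrix (P (matrix_unit i j)) i j)"
  unfolding is_schur_multiplication_def
proof (intro allI ext)
  fix T i j
  have "op_matrix (P T) i j = op_matrix (diag_proj {i} * P T * diag_proj {j}) i j"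
    by (simp add: op_matrix_diag_proj)
  also have "diag_proj {i} * P T * diag_proj {j} = P (diag_proj {i} * T * diag_proj {j})"
    by (simp add: diag_proj_def bimodule bounded_range_indicator)
  also have "op_matrix \<dots> i j = op_matrix T i j * op_matrix (P (matrix_unit i j)) i j"
    by (simp add: diag_proj_singletons complex_linear op_matrix_scaleC)
  finally show "op_matrix (P T) i j
      = schur_mult (\<lambda>i j. op_matrix (P (matrix_unit i j)) i j) (op_matrix T) i j"
    by (simp add: schur_mult_def)
qed

lemma idempotent_schur_multiplication_pattern:
  assumes "is_schur_multiplication P A" and "P \<circ> P = P"
  obtains E where "is_schur_multiplication P (char_matrix E)"
proof -
  have entry: "op_matrix (P T) i j = A i j * op_matrix T i j" for T i j
    using assms(1) by (simp add: is_schur_multiplication_def schur_mult_def)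
  have "A i j = 0 \<or> A i j = 1" for i j
  proof -
    have "P (P (matrix_unit i j)) = P (matrix_unit i j)"
      using assms(2) by (metis comp_apply)
    then have "A i j * A i j = A i j"
      using entry[of "P (matrix_unit i j)" i j] entry[of "matrix_unit i j" i j]
      by (simp add: op_matrix_unit)
    then show ?thesis by simp
  qed
  then have "A = char_matrix {(i, j). A i j = 1}"
    by (auto simp: fun_eq_iff char_matrix_def indicator_def)
  with assms(1) that show thesis by metis
qed

lemma op_matrix_schur_idempotent:
  assumes "is_schur_multiplication P (char_matrix E)"
  shows "op_matrix (P T) i j = (if (i, j) \<in> E then op_matrix T i j else 0)"
  using assms by (simp add: is_schur_multiplication_def schur_mult_def char_matrix_def)

text \<open>An operator supported in \<open>E\<close> is fixed by \<open>P\<close>, so membership in the range can be read off the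
  matrix. All later statements about the range go through this description.\<close>

lemma mem_range_schur_idempotent:
  assumes "is_schur_multiplication P (char_matrix E)"
  shows "T \<in> range P \<longleftrightarrow> (\<forall>i j. (i, j) \<notin> E \<longrightarrow> op_matrix T i j = 0)"
proof
  assume "\<forall>i j. (i, j) \<notin> E \<longrightarrow> op_matrix T i j = 0"
  then have "P T = T"
    by (intro op_matrix_eqI) (simp add: op_matrix_schur_idempotent[OF assms])
  then show "T \<in> range P" by (metis rangeI)
qed (auto simp: op_matrix_schur_idempotent[OF assms])

section \<open>Small norm forces a difunctional pattern\<close>

text \<open>Equivalently, no pair of rows and pair of columns contains exactly three points of \<open>E\<close>. The
  relational form makes visible that this is the condition \<open>M M* M \<subseteq> M\<close> for patterns.\<close>

definition difunctional :: "('a \<times> 'b) set \<Rightarrow> bool" where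
  "difunctional E \<longleftrightarrow> E O E\<inverse> O E \<subseteq> E"

lemma difunctionalD:
  assumes "difunctional E" "(i, j) \<in> E" "(i, j') \<in> E" "(i', j) \<in> E"
  shows "(i', j') \<in> E"
  using assms unfolding difunctional_def by blast

lemma norm_two_basis_power2:
  assumes "i \<noteq> i'"
  shows "(norm (scaleC_ell2 p (ell2_basis i) + scaleC_ell2 q (ell2_basis i')))\<^sup>2
    = (cmod p)\<^sup>2 + (cmod q)\<^sup>2"
  unfolding norm_ell2_power2 using assms
  by (subst suminf_finite[of "{i, i'}"])
     (auto simp: plus_ell2.rep_eq scaleC_ell2.rep_eq ell2_basis.rep_eq)

text \<open>Three points of \<open>E\<close> without the fourth give a pair of rows and a pair of columns on which
  \<open>P\<close> deletes one corner of a two by two matrix. Deleting the corner of the symmetric unitary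
  \<open>(a, b; b, -a)\<close> leaves \<open>(a, b; b, 0)\<close>, whose largest eigenvalue is \<open>(a + sqrt (4 - 3a\<^sup>2)) / 2\<close>.
  It is maximal at \<open>a = 1 / sqrt 3\<close>, with value \<open>2 / sqrt 3\<close> and eigenvector \<open>(sqrt 2, 1)\<close>.\<close>

lemma difunctional_if_norm_less:
  assumes schur: "is_schur_multiplication P (char_matrix E)"
    and bounded: "bounded_linear P"
    and norm_less: "onorm P < 2 / sqrt 3"
  shows "difunctional E"
proof (rule ccontr)
  assume "\<not> difunctional E"
  then obtain i i' j j' where E: "(i, j) \<in> E" "(i, j') \<in> E" "(i', j) \<in> E" "(i', j') \<notin> E"
    by (auto simp: difunctional_def)
  then have ne: "i \<noteq> i'" "j \<noteq> j'" by auto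
  define a where "a = 1 / sqrt 3"
  define b where "b = sqrt 2 / sqrt 3"
  have ab: "a\<^sup>2 + b\<^sup>2 = 1" by (simp add: a_def b_def power_divide)
  define T where "T = scaleC_op (complex_of_real a) (matrix_unit i j)
    + scaleC_op (complex_of_real b) (matrix_unit i j')
    + scaleC_op (complex_of_real b) (matrix_unit i' j)
    + scaleC_op (complex_of_real (- a)) (matrix_unit i' j')"
  define v where "v = scaleC_ell2 (complex_of_real (sqrt 2)) (ell2_basis j)
    + scaleC_ell2 1 (ell2_basis j')"
  have T_apply: "op_apply T x
      = scaleC_ell2 (a * ell2_nth x j + b * ell2_nth x j') (ell2_basis i)
        + scaleC_ell2 (b * ell2_nth x j - a * ell2_nth x j') (ell2_basis i')" for x
    by (rule ell2_eqI) (simp add: T_def op_apply_simps op_apply_scaleC_op op_apply_matrix_unit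
        plus_ell2.rep_eq scaleC_ell2.rep_eq algebra_simps del: ell2_op.scale_minus_left)
  \<comment> \<open>Unitarity of \<open>(a, b; b, -a)\<close>.\<close>
  have rotation: "(cmod (a * z + b * w))\<^sup>2 + (cmod (b * z - a * w))\<^sup>2
      = (cmod z)\<^sup>2 + (cmod w)\<^sup>2" for z w :: complex
  proof -
    have "(cmod (a * z + b * w))\<^sup>2 + (cmod (b * z - a * w))\<^sup>2
      = (a\<^sup>2 + b\<^sup>2) * ((cmod z)\<^sup>2 + (cmod w)\<^sup>2)"
      by (simp add: cmod_power2) (simp add: power2_eq_square algebra_simps)
    then show ?thesis by (simp add: ab)
  qed
  have T_norm: "norm T \<le> 1"
  proof (rule norm_op_le_of_power2)
    fix x
    have "(norm (op_apply T x))\<^sup>2 = (\<Sum>n\<in>{j, j'}. (cmod (ell2_nth x n))\<^sup>2)"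
      unfolding T_apply norm_two_basis_power2[OF ne(1)] rotation using ne(2) by simp
    also have "\<dots> \<le> (norm x)\<^sup>2" by (rule sum_nth_le_norm_power2) simp
    finally show "(norm (op_apply T x))\<^sup>2 \<le> (1 * norm x)\<^sup>2" by simp
  qed simp
  have PT: "P T = scaleC_op (complex_of_real a) (matrix_unit i j)
    + scaleC_op (complex_of_real b) (matrix_unit i j')
    + scaleC_op (complex_of_real b) (matrix_unit i' j)"
    using E ne by (intro op_matrix_eqI)
      (auto simp: op_matrix_schur_idempotent[OF schur] T_def op_matrix_add op_matrix_scaleC
        op_matrix_unit simp del: ell2_op.scale_minus_left)
  have PT_apply: "op_apply (P T) x
      = scaleC_ell2 (a * ell2_nth x j + b * ell2_nth x j') (ell2_basis i)
        + scaleC_ell2 (b * ell2_nth x j) (ell2_basis i')" for x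
    by (rule ell2_eqI) (simp add: PT op_apply_simps op_apply_scaleC_op op_apply_matrix_unit
        plus_ell2.rep_eq scaleC_ell2.rep_eq algebra_simps)
  have v_nth: "ell2_nth v j = complex_of_real (sqrt 2)" "ell2_nth v j' = 1"
    using ne by (simp_all add: v_def plus_ell2.rep_eq scaleC_ell2.rep_eq ell2_basis.rep_eq)
  have "op_apply (P T) v = scaleC_ell2 (a * sqrt 2 + b) (ell2_basis i)
      + scaleC_ell2 (b * sqrt 2) (ell2_basis i')"
    unfolding PT_apply v_nth by simp
  then have "(norm (op_apply (P T) v))\<^sup>2 = (cmod (a * sqrt 2 + b))\<^sup>2 + (cmod (b * sqrt 2))\<^sup>2"
    by (simp only: norm_two_basis_power2[OF ne(1)])
  also have "\<dots> = (a * sqrt 2 + b)\<^sup>2 + (b * sqrt 2)\<^sup>2"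
    by (simp only: norm_of_real power2_abs flip: of_real_mult of_real_add)
  also have "\<dots> = 2\<^sup>2" by (simp add: a_def b_def power_divide power_mult_distrib)
  finally have PTv: "norm (op_apply (P T) v) = 2"
    by (rule power2_eq_imp_eq) simp_all
  have "(norm v)\<^sup>2 = 3"
    unfolding v_def norm_two_basis_power2[OF ne(2)] by simp
  then have v_norm: "norm v = sqrt 3"
    by (intro real_sqrt_unique[symmetric]) simp_all
  have "norm (P T) \<le> onorm P * norm T" by (rule onorm[OF bounded])
  also have "\<dots> \<le> onorm P"
    using mult_left_mono[OF T_norm onorm_pos_le[OF bounded]] by simp
  finally have "norm (P T) < 2 / sqrt 3" using norm_less by simp
  \<comment> \<open>\<open>P T\<close> stretches \<open>v\<close> from length \<open>sqrt 3\<close> to \<open>2\<close>, more than its norm allows.\<close>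
  then have "norm (P T) * norm v < 2" by (simp add: v_norm field_simps)
  with norm_op_apply_le[of "P T" v] PTv show False by simp
qed

section \<open>Difunctional patterns are unions of disjoint rectangles\<close>

text \<open>Rows that share a column are equal, so a nonempty row is determined by its least column.
  Numbering the rectangles by that column gives families indexed by all of \<open>\<nat>\<close>, with empty
  rectangles at the numbers that are not the least column of any row.\<close>

lemma difunctional_rectangles:
  fixes E :: "(nat \<times> nat) set"
  assumes "difunctional E"
  obtains I J :: "nat \<Rightarrow> nat set" where
    "disjoint_family I" "disjoint_family J" "E = (\<Union>m. I m \<times> J m)"
proof
  define c where "c i = (LEAST j. (i, j) \<in> E)" for i
  define I where "I m = {i \<in> Domain E. c i = m}" for m
  define J where "J m = E `` I m" for m
  have c: "(i, c i) \<in> E" if "i \<in> Domain E" for i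
    using that unfolding c_def by (auto intro: LeastI)
  have c_eq: "c i = c i'" if "(i, j) \<in> E" "(i', j) \<in> E" for i i' j
  proof -
    have "(i, k) \<in> E \<longleftrightarrow> (i', k) \<in> E" for k
      using that difunctionalD[OF assms] by blast
    then show ?thesis by (simp add: c_def)
  qed
  show "disjoint_family I" by (auto simp: disjoint_family_on_def I_def)
  show "disjoint_family J" using c_eq by (auto simp: disjoint_family_on_def I_def J_def)
  show "E = (\<Union>m. I m \<times> J m)"
  proof
    show "E \<subseteq> (\<Union>m. I m \<times> J m)" by (auto simp: I_def J_def)
    show "(\<Union>m. I m \<times> J m) \<subseteq> E"
    proof clarify
      fix m i j assume "i \<in> I m" "j \<in> J m"
      then obtain i' where "i \<in> Domain E" "i' \<in> Domain E" "c i = c i'" "(i', j) \<in> E"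
        unfolding I_def J_def by force
      then show "(i, j) \<in> E" using c[of i] c[of i'] difunctionalD[OF assms] by metis
    qed
  qed
qed

section \<open>The range is a ternary ring of operators\<close>

text \<open>The entry at \<open>(i, j)\<close> is a double series of products \<open>R\<^sub>i\<^sub>l * cnj S\<^sub>k\<^sub>l * T\<^sub>k\<^sub>j\<close>. A nonzero term
  would put \<open>(i, l)\<close>, \<open>(k, l)\<close> and \<open>(k, j)\<close> into \<open>E\<close>, hence also \<open>(i, j)\<close>.\<close>

lemma range_ternary_closed:
  assumes schur: "is_schur_multiplication P (char_matrix E)"
    and difun: "difunctional E"
    and "R \<in> range P" "S \<in> range P" "T \<in> range P"
  shows "R * op_adj S * T \<in> range P"
proof -
  have supp: "(k, l) \<in> E" if "op_matrix X k l \<noteq> 0" "X \<in> range P" for X k l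
    using that mem_range_schur_idempotent[OF schur] by metis
  have "op_matrix (R * op_adj S * T) i j = 0" if "(i, j) \<notin> E" for i j
  proof -
    let ?u = "op_apply T (ell2_basis j)"
    have u: "(k, j) \<in> E" if "ell2_nth ?u k \<noteq> 0" for k
      using supp[of T k j] that assms by (simp add: op_matrix_eq_nth)
    have "op_matrix R i l * ell2_nth (op_apply (op_adj S) ?u) l = 0" for l
    proof (cases "(i, l) \<in> E")
      case True
      have "op_matrix (op_adj S) l k * ell2_nth ?u k = 0" for k
      proof (rule ccontr)
        assume "op_matrix (op_adj S) l k * ell2_nth ?u k \<noteq> 0"
        then have "(k, l) \<in> E" "(k, j) \<in> E"
          using supp[of S k l] u assms by (auto simp: op_matrix_adj)
        with True difunctionalD[OF difun] \<open>(i, j) \<notin> E\<close> show False by blast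
      qed
      then have "ell2_nth (op_apply (op_adj S) ?u) l = 0"
        by (simp only: nth_op_apply[of "op_adj S"] suminf_zero)
      then show ?thesis by simp
    next
      case False
      then show ?thesis using supp[of R i l] assms by auto
    qed
    then have "ell2_nth (op_apply R (op_apply (op_adj S) ?u)) i = 0"
      by (simp only: nth_op_apply[of R] suminf_zero)
    then show ?thesis by (simp add: op_matrix_eq_nth op_apply_simps)
  qed
  then show ?thesis using mem_range_schur_idempotent[OF schur] by blast
qed

section \<open>Rectangular Schur idempotents are contractive\<close>

lemma sum_norm_diag_proj_disjoint_le:
  assumes "finite A" and disj: "disjoint_family J"
  shows "(\<Sum>m\<in>A. (norm (op_apply (diag_proj (J m)) x))\<^sup>2) \<le> (norm x)\<^sup>2"
proof -
  let ?f = "\<lambda>m n. indicator (J m) n * (cmod (ell2_nth x n))\<^sup>2"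
  have summ: "summable (?f m)" for m
    by (rule summable_comparison_test'[OF ell2_nth_square_summable[of x]])
       (simp add: indicator_def)
  have "(\<Sum>m\<in>A. (norm (op_apply (diag_proj (J m)) x))\<^sup>2) = (\<Sum>n. \<Sum>m\<in>A. ?f m n)"
    unfolding norm_diag_proj_power2 by (rule suminf_sum[symmetric]) (rule summ)
  also have "\<dots> \<le> (\<Sum>n. (cmod (ell2_nth x n))\<^sup>2)"
  proof (intro suminf_le summable_sum summ ell2_nth_square_summable)
    fix n
    have "(\<Sum>m\<in>A. indicator (J m) n :: real) \<le> 1"
    proof (cases "\<exists>m\<in>A. n \<in> J m")
      case True
      then obtain m where m: "m \<in> A" "n \<in> J m" by blast
      have "indicator (J m') n = (if m' = m then 1 else 0 :: real)" for m'
        using disj m(2) by (auto simp: disjoint_family_on_def indicator_def)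
      then show ?thesis using \<open>finite A\<close> m(1) by simp
    qed (simp add: indicator_def)
    then show "(\<Sum>m\<in>A. ?f m n) \<le> (cmod (ell2_nth x n))\<^sup>2"
      by (simp add: mult_left_le_one_le sum_nonneg flip: sum_distrib_right)
  qed
  finally show ?thesis by (simp add: norm_ell2_power2)
qed

text \<open>On the rows in \<open>I m\<close> the vector \<open>P T x\<close> agrees with \<open>T\<close> applied to the part of \<open>x\<close> in \<open>J m\<close>.
  Hence the square of its norm is at most the sum over \<open>m\<close> of the squares of \<open>norm T\<close> times the
  norms of these parts, which are orthogonal to each other. Only finitely many rows are added up
  at a time, so that the sum over \<open>m\<close> is finite too.\<close>

lemma norm_rectangular_schur_idempotent_le:
  assumes schur: "is_schur_multiplication P (char_matrix (\<Union>m. I m \<times> J m))"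
    and I: "disjoint_family I" and J: "disjoint_family J"
  shows "norm (P T) \<le> norm T"
proof (rule norm_op_le_of_power2)
  fix x
  let ?y = "op_apply (P T) x" and ?z = "\<lambda>m. op_apply T (op_apply (diag_proj (J m)) x)"
  have row: "ell2_nth ?y i = ell2_nth (?z m) i" if "i \<in> I m" for i m
  proof -
    have "(i, j) \<in> (\<Union>m. I m \<times> J m) \<longleftrightarrow> j \<in> J m" for j
    proof -
      have "m' = m" if "i \<in> I m'" for m'
        using that \<open>i \<in> I m\<close> I by (auto simp: disjoint_family_on_def)
      then show ?thesis using that by blast
    qed
    then show ?thesis
      unfolding nth_op_apply[of "P T"] nth_op_apply[of T]
      by (intro suminf_cong) (simp add: op_matrix_schur_idempotent[OF schur] nth_diag_proj indicator_def)
  qed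
  have zero_row: "ell2_nth ?y i = 0" if "\<And>m. i \<notin> I m" for i
    using that by (simp add: nth_op_apply op_matrix_schur_idempotent[OF schur])
  have "(\<Sum>i<N. (cmod (ell2_nth ?y i))\<^sup>2) \<le> (norm T * norm x)\<^sup>2" for N
  proof -
    \<comment> \<open>A row outside every \<open>I m\<close> gets an arbitrary value of \<open>f\<close>, which only adds nonnegative
      terms to the sum over \<open>A\<close>.\<close>
    define f where "f i = (SOME m. i \<in> I m)" for i
    have f: "i \<in> I (f i)" if "i \<in> I m" for i m
      unfolding f_def using that by (rule someI)
    define A where "A = f ` {..<N}"
    have "(\<Sum>i<N. (cmod (ell2_nth ?y i))\<^sup>2) \<le> (\<Sum>i<N. \<Sum>m\<in>A. (cmod (ell2_nth (?z m) i))\<^sup>2)"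
    proof (rule sum_mono)
      fix i assume "i \<in> {..<N}"
      show "(cmod (ell2_nth ?y i))\<^sup>2 \<le> (\<Sum>m\<in>A. (cmod (ell2_nth (?z m) i))\<^sup>2)"
      proof (cases "\<exists>m. i \<in> I m")
        case True
        then have "ell2_nth ?y i = ell2_nth (?z (f i)) i" using row f by blast
        moreover have "(cmod (ell2_nth (?z (f i)) i))\<^sup>2 \<le> (\<Sum>m\<in>A. (cmod (ell2_nth (?z m) i))\<^sup>2)"
          using \<open>i \<in> {..<N}\<close> by (intro member_le_sum) (auto simp: A_def)
        ultimately show ?thesis by simp
      qed (simp add: zero_row sum_nonneg)
    qed
    also have "\<dots> = (\<Sum>m\<in>A. \<Sum>i<N. (cmod (ell2_nth (?z m) i))\<^sup>2)" by (rule sum.swap)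
    also have "\<dots> \<le> (\<Sum>m\<in>A. (norm (?z m))\<^sup>2)"
      by (intro sum_mono sum_nth_le_norm_power2) simp
    also have "\<dots> \<le> (\<Sum>m\<in>A. (norm T)\<^sup>2 * (norm (op_apply (diag_proj (J m)) x))\<^sup>2)"
      unfolding power_mult_distrib[symmetric]
      by (intro sum_mono power_mono norm_op_apply_le) simp
    also have "\<dots> \<le> (norm T)\<^sup>2 * (norm x)\<^sup>2"
      unfolding sum_distrib_left[symmetric]
      by (intro mult_left_mono sum_norm_diag_proj_disjoint_le J) (simp_all add: A_def)
    finally show ?thesis by (simp add: power_mult_distrib)
  qed
  then show "(norm ?y)\<^sup>2 \<le> (norm T * norm x)\<^sup>2"
    unfolding norm_ell2_power2 by (intro suminf_le_const ell2_nth_square_summable)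
qed simp

lemma onorm_contractive_idempotent:
  fixes P :: "'a :: real_normed_vector \<Rightarrow> 'a"
  assumes "bounded_linear P" "P \<circ> P = P" "P \<noteq> (\<lambda>_. 0)" "\<And>x. norm (P x) \<le> norm x"
  shows "onorm P = 1"
proof (rule antisym)
  show "onorm P \<le> 1" using assms(4) by (intro onorm_bound) simp_all
  obtain x where x: "P x \<noteq> 0" using assms(3) by auto
  have "norm (P (P x)) \<le> onorm P * norm (P x)" by (rule onorm[OF assms(1)])
  moreover have "P (P x) = P x" using assms(2) by (metis comp_apply)
  ultimately show "1 \<le> onorm P" using x by simp
qed

section \<open>The range as a weak* closed sum of corners\<close>

lemma op_matrix_weak_star_functional: "(\<lambda>T. op_matrix T i j) \<in> weak_star_functionals"
proof -
  let ?x = "\<lambda>k :: nat. if k = 0 then ell2_basis j else 0"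
  let ?y = "\<lambda>k :: nat. if k = 0 then ell2_basis i else 0"
  have "(\<lambda>T. op_matrix T i j) = (\<lambda>T. \<Sum>k. cinner (op_apply T (?x k)) (?y k))"
    by (rule ext, subst suminf_finite[of "{0}"])
       (auto simp: op_matrix_def linear_0[OF bounded_linear.linear[OF bounded_linear_op_apply]]
         cinner_zero_left)
  moreover have "summable (\<lambda>k. (norm (?x k))\<^sup>2)" "summable (\<lambda>k. (norm (?y k))\<^sup>2)"
    by (rule summable_finite[of "{0}"]; simp)+
  ultimately show ?thesis
    unfolding weak_star_functionals_def by (intro CollectI exI conjI)
qed

lemma closedin_weak_star_range:
  assumes "is_schur_multiplication P (char_matrix E)"
  shows "closedin weak_star_topology (range P)"
proof -
  have "- range P = (\<Union>p\<in>- E. (\<lambda>T. op_matrix T (fst p) (snd p)) -` (- {0}))"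
    unfolding set_eq_iff Compl_iff mem_range_schur_idempotent[OF assms] by force
  moreover have "openin weak_star_topology ((\<lambda>T. op_matrix T i j) -` (- {0}))" for i j
    unfolding weak_star_topology_def
    by (rule topology_generated_by_Basis)
       (use op_matrix_weak_star_functional open_Compl closed_singleton in blast)
  ultimately show ?thesis
    by (auto simp: closedin_def Compl_eq_Diff_UNIV[symmetric])
qed

text \<open>Convergence under every functional is convergence in the topology which they generate: the
  property of containing almost all of the \<open>X n\<close> passes from subbasic sets to all open sets.\<close>

lemma eventually_in_weak_star_open:
  assumes lim: "\<And>\<phi>. \<phi> \<in> weak_star_functionals \<Longrightarrow> ((\<lambda>n. \<phi> (X n)) \<longlongrightarrow> \<phi> T) F"
    and "openin weak_star_topology U" "T \<in> U"
  shows "\<forall>\<^sub>F n in F. X n \<in> U"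
  using assms(2) unfolding weak_star_topology_def openin_topology_generated_by_iff
  using \<open>T \<in> U\<close>
proof (induction rule: generate_topology_on.induct)
  case (Int a b)
  then show ?case by (auto intro: eventually_conj)
next
  case (UN K)
  then obtain k where "k \<in> K" "\<forall>\<^sub>F n in F. X n \<in> k" by blast
  then show ?case by (auto elim: eventually_mono)
next
  case (Basis s)
  then obtain \<phi> V where "s = \<phi> -` V" "\<phi> \<in> weak_star_functionals" "open V" by blast
  with lim Basis.prems show ?case by (auto dest: topological_tendstoD)
qed simp

lemma bounded_bilinear_cinner: "bounded_bilinear cinner"
proof
  show "\<exists>K. \<forall>x y. norm (cinner x y) \<le> norm x * norm y * K"
    by (rule exI[of _ 1]) (simp add: cinner_Cauchy_Schwarz)
qed (simp_all add: cinner_add_left cinner_add_right scaleR_ell2_scaleC cinner_scaleC_left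
    cinner_scaleC_right scaleR_conv_of_real)

lemma diag_proj_lessThan: "op_apply (diag_proj {..<n}) x = ell2_trunc n (ell2_nth x)"
  by (rule ell2_eqI) (simp add: nth_diag_proj ell2_nth_trunc)

lemma cinner_diag_proj_left:
  "cinner (op_apply (diag_proj S) x) y = cinner x (op_apply (diag_proj S) y)"
  unfolding cinner_def by (rule suminf_cong) (simp add: nth_diag_proj indicator_def)

text \<open>Each term of the series that defines the functional converges, since the truncations of a
  vector converge to it in norm. The terms are dominated by
  \<open>norm T * ((norm (x k))\<^sup>2 + (norm (y k))\<^sup>2)\<close>, so Tannery's theorem gives convergence of the sums.\<close>

lemma compression_tendsto_weak_star:
  assumes "\<phi> \<in> weak_star_functionals"
  shows "(\<lambda>n. \<phi> (diag_proj {..<n} * T * diag_proj {..<n})) \<longlonglongrightarrow> \<phi> T"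
proof -
  obtain x y where \<phi>: "\<phi> = (\<lambda>T. \<Sum>k. cinner (op_apply T (x k)) (y k))"
    and x: "summable (\<lambda>k. (norm (x k))\<^sup>2)" and y: "summable (\<lambda>k. (norm (y k :: ell2))\<^sup>2)"
    using assms unfolding weak_star_functionals_def by blast
  let ?F = "\<lambda>n. diag_proj {..<n}"
  let ?a = "\<lambda>k n. cinner (op_apply T (op_apply (?F n) (x k))) (op_apply (?F n) (y k))"
  have lim: "(\<lambda>n. ?a k n) \<longlonglongrightarrow> cinner (op_apply T (x k)) (y k)" for k
    unfolding diag_proj_lessThan
    by (intro bounded_bilinear.tendsto[OF bounded_bilinear_cinner] ell2_trunc_tendsto
        bounded_linear.tendsto[OF bounded_linear_op_apply])
  have bound: "norm (?a k n) \<le> norm T * ((norm (x k))\<^sup>2 + (norm (y k))\<^sup>2)" for k n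
  proof -
    have "norm (?a k n) \<le> (norm T * norm (op_apply (?F n) (x k))) * norm (op_apply (?F n) (y k))"
      by (rule order_trans[OF cinner_Cauchy_Schwarz mult_right_mono[OF norm_op_apply_le]]) simp
    also have "\<dots> \<le> (norm T * norm (x k)) * norm (y k)"
      by (intro mult_mono norm_diag_proj_le) simp_all
    also have "\<dots> \<le> norm T * ((norm (x k))\<^sup>2 + (norm (y k))\<^sup>2)"
      using sum_squares_bound[of "norm (x k)" "norm (y k)"]
        mult_nonneg_nonneg[OF norm_ge_zero[of "x k"] norm_ge_zero[of "y k"]]
      unfolding mult.assoc by (intro mult_left_mono norm_ge_zero) linarith
    finally show ?thesis .
  qed
  have "(\<lambda>n. \<Sum>k. ?a k n) \<longlonglongrightarrow> (\<Sum>k. cinner (op_apply T (x k)) (y k))"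
    using tannerys_theorem[OF lim, where M = "\<lambda>k. norm T * ((norm (x k))\<^sup>2 + (norm (y k))\<^sup>2)"]
    by (simp add: bound case_prod_unfold summable_mult summable_add x y)
  then show ?thesis by (simp add: \<phi> op_apply_simps cinner_diag_proj_left)
qed

text \<open>The range is a weak* closed subspace which contains the corners, and therefore their weak*
  closed span. Conversely, the finite compressions of an operator in the range lie in the
  algebraic span of the corners and converge to it.\<close>

lemma range_rectangular_schur_idempotent:
  assumes schur: "is_schur_multiplication P (char_matrix (\<Union>m. I m \<times> J m))"
  shows "range P = weak_star_closed_sum
    (\<lambda>m. {diag_proj (I m) * T * diag_proj (J m) | T. True})"
proof -
  note mem = mem_range_schur_idempotent[OF schur]
  let ?C = "\<Union>m. {diag_proj (I m) * T * diag_proj (J m) | T. True}"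
  have "ell2_op.subspace (range P)"
    unfolding ell2_op.subspace_def Ball_def mem
    by (simp add: op_matrix_zero op_matrix_add op_matrix_scaleC)
  moreover have "?C \<subseteq> range P"
    by (auto simp: mem op_matrix_diag_proj simp del: rangeI)
  ultimately have "ell2_op.span ?C \<subseteq> range P"
    by (intro ell2_op.span_minimal)
  then have closure_le: "weak_star_topology closure_of ell2_op.span ?C \<subseteq> range P"
    by (rule closure_of_minimal[OF _ closedin_weak_star_range[OF schur]])
  have "T \<in> weak_star_topology closure_of ell2_op.span ?C" if "T \<in> range P" for T
  proof -
    let ?X = "\<lambda>n. diag_proj {..<n} * T * diag_proj {..<n}"
    have unit: "scaleC_op (op_matrix T i j) (matrix_unit i j) \<in> ell2_op.span ?C" for i j
    proof (cases "\<exists>m. i \<in> I m \<and> j \<in> J m")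
      case True
      then obtain m where m: "i \<in> I m" "j \<in> J m" by blast
      let ?U = "scaleC_op (op_matrix T i j) (matrix_unit i j)"
      have "?U = diag_proj (I m) * ?U * diag_proj (J m)"
        by (rule op_matrix_eqI)
           (auto simp: op_matrix_diag_proj op_matrix_scaleC op_matrix_unit m)
      then show ?thesis by (intro ell2_op.span_base) blast
    next
      case False
      then have "op_matrix T i j = 0" using that mem by blast
      then show ?thesis by (simp add: ell2_op.span_zero)
    qed
    have "?X n = (\<Sum>(i, j)\<in>{..<n} \<times> {..<n}. scaleC_op (op_matrix T i j) (matrix_unit i j))" for n
    proof (rule op_matrix_eqI)
      fix k l
      have "(\<Sum>p\<in>{..<n} \<times> {..<n}. op_matrix (scaleC_op (op_matrix T (fst p) (snd p)) (matrix_unit (fst p) (snd p))) k l)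
        = (\<Sum>p\<in>{..<n} \<times> {..<n}. if p = (k, l) then op_matrix T k l else 0)"
        by (rule sum.cong) (auto simp: op_matrix_scaleC op_matrix_unit)
      then show "op_matrix (?X n) k l = op_matrix
        (\<Sum>(i, j)\<in>{..<n} \<times> {..<n}. scaleC_op (op_matrix T i j) (matrix_unit i j)) k l"
        by (simp add: op_matrix_sum op_matrix_diag_proj case_prod_unfold)
    qed
    then have X: "?X n \<in> ell2_op.span ?C" for n
      by (simp only: case_prod_unfold) (intro ell2_op.span_sum unit)
    show ?thesis
      unfolding in_closure_of
    proof (intro conjI allI impI)
      fix U assume "T \<in> U \<and> openin weak_star_topology U"
      then have "\<forall>\<^sub>F n in sequentially. ?X n \<in> U"
        by (intro eventually_in_weak_star_open[OF compression_tendsto_weak_star]) auto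
      then obtain n where "?X n \<in> U" by (auto simp: eventually_sequentially)
      with X show "\<exists>Y. Y \<in> ell2_op.span ?C \<and> Y \<in> U" by blast
    qed simp
  qed
  with closure_le show ?thesis unfolding weak_star_closed_sum_def by blast
qed

section \<open>The structure of bimodule projections of small norm\<close>

theorem theorem4:
  fixes P :: "ell2_op \<Rightarrow> ell2_op"
  assumes bounded: "bounded_linear P"
    and complex_linear: "\<And>c T. P (scaleC_op c T) = scaleC_op c (P T)"
    and idempotent: "P \<circ> P = P"
    and nonzero: "P \<noteq> (\<lambda>_. 0)"
    and bimodule: "\<And>d1 d2 T. bounded (range d1) \<Longrightarrow> bounded (range d2) \<Longrightarrow>
       P (diag_op d1 * T * diag_op d2) = diag_op d1 * P T * diag_op d2"
    and norm_less: "onorm P < 2 / sqrt 3"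
  shows "(\<exists>I J :: nat \<Rightarrow> nat set.
            disjoint_family I \<and> disjoint_family J
          \<and> is_schur_multiplication P (char_matrix (\<Union>m. I m \<times> J m))
          \<and> range P = weak_star_closed_sum
                (\<lambda>m. {diag_proj (I m) * T * diag_proj (J m) | T. True}))
       \<and> (\<forall>m1 \<in> range P. \<forall>m2 \<in> range P. \<forall>m3 \<in> range P. m1 * op_adj m2 * m3 \<in> range P)
       \<and> onorm P = 1"
proof -
  obtain E where schur: "is_schur_multiplication P (char_matrix E)"
    using idempotent_schur_multiplication_pattern
      [OF bimodule_map_is_schur_multiplication[OF complex_linear bimodule] idempotent] by blast
  have difun: "difunctional E"
    by (rule difunctional_if_norm_less[OF schur bounded norm_less])
  obtain I J :: "nat \<Rightarrow> nat set" where
    IJ: "disjoint_family I" "disjoint_family J" and E: "E = (\<Union>m. I m \<times> J m)"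
    using difunctional_rectangles[OF difun] .
  note schur' = schur[unfolded E]
  have "onorm P = 1"
    using bounded idempotent nonzero norm_rectangular_schur_idempotent_le[OF schur' IJ]
    by (rule onorm_contractive_idempotent)
  moreover have "range P = weak_star_closed_sum
      (\<lambda>m. {diag_proj (I m) * T * diag_proj (J m) | T. True})"
    by (rule range_rectangular_schur_idempotent[OF schur'])
  ultimately show ?thesis
    using IJ schur' range_ternary_closed[OF schur difun] by blast
qed

end
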